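(* Let $\{X_M\}_{M\geq 2}$ be a good covering of the sphere $S^2\subset\mathbb{R}^3$ with constant $\alpha>0$, i.e. each $X_M\subset S^2$ is a finite set of cardinality $M$ with $\eta(X_M)\leq\alpha/\sqrt{M}$. Then for every fixed $\theta\in(0,1)$ the sequence $\mathcal{A}_n=X_{M_n}$, $n\geq 1$, with $$M_n=\lceil\sigma_n^2n^2\rceil,\qquad \sigma_n=\frac{2\pi\alpha}{\theta(2\pi-\theta/n)}\sim\frac{\alpha}{\theta}\quad(n\to\infty),$$ is an optimal polynomial mesh of $S^2$ with constant $C=1/(1-\theta)$.
   Context: $S^2$ is the unit sphere of $\mathbb{R}^3$. The covering radius of a finite set $X_M\subset S^2$ is $\eta(X_M)=\max_{x\in S^2}\min_{y\in X_M}|x-y|$, with $|\cdot|$ the Euclidean norm of $\mathbb{R}^3$. $\mathbb{P}_n^d(K)$ denotes the space of restrictions to a compact $K\subset\mathbb{R}^d$ of real $d$-variate polynomials of total degree at most $n$, and $N=N_n(K)=\dim\mathbb{P}_n^d(K)$; for $K=S^2$ ($d=3$), $N=(n+1)^2$. A polynomial mesh of $K$ with constant $C$ is a sequence of finite subsets $\mathcal{A}_n\subset K$ such that $\|p\|_{L^\infty(K)}\leq C\,\|p\|_{\ell^\infty(\mathcal{A}_n)}$ for all $p\in\mathbb{P}_n^d(K)$ and all $n\geq 1$, with $C$ independent of $n$ and $p$, and $\mathrm{card}(\mathcal{A}_n)=\mathcal{O}(N^\beta)$ for some $\beta\geq 1$. It is optimal when $\beta=1$, i.e. $\mathrm{card}(\mathcal{A}_n)=\mathcal{O}(N)$.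 *)

theory Defs
  imports "HOL-Analysis.Analysis" "HOL-Library.Function_Algebras" "HOL-Library.Landau_Symbols"
begin

global_interpretation fun_space: vector_space "\<lambda>(c::real) (f :: 'a \<Rightarrow> real) x. c * f x"
  by unfold_locales (auto simp: fun_eq_iff algebra_simps)

(* A multi-index is a function 'd => nat; the index set of the sum is finite since 'd is. *)
definition poly_funs :: "nat \<Rightarrow> (real ^ 'd \<Rightarrow> real) set" where
  "poly_funs n =
     {p. \<exists>c :: ('d \<Rightarrow> nat) \<Rightarrow> real.
        p = (\<lambda>x. \<Sum>a | (\<Sum>i\<in>UNIV. a i) \<le> n. c a * (\<Prod>i\<in>UNIV. (x $ i) ^ a i))}"

(* A function on K is represented by its extension by 0, so that equality on K is equality
   and the dimension below is that of a space of functions on K. *)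
definition poly_space :: "(real ^ 'd) set \<Rightarrow> nat \<Rightarrow> (real ^ 'd \<Rightarrow> real) set" where
  "poly_space K n = (\<lambda>p x. if x \<in> K then p x else 0) ` poly_funs n"

definition poly_dim :: "(real ^ 'd) set \<Rightarrow> nat \<Rightarrow> nat" where
  "poly_dim K n = fun_space.dim (poly_space K n)"

(* The case distinction is needed because Sup {} is unspecified on the reals. *)
definition sup_norm :: "'a set \<Rightarrow> ('a \<Rightarrow> real) \<Rightarrow> real" where
  "sup_norm S f = (if S = {} then 0 else (SUP x\<in>S. \<bar>f x\<bar>))"

(* Only the sets with index n \<ge> 1 matter; A 0 is irrelevant. *)
definition polynomial_mesh :: "(real ^ 'd) set \<Rightarrow> real \<Rightarrow> (nat \<Rightarrow> (real ^ 'd) set) \<Rightarrow> bool" where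
  "polynomial_mesh K C A \<longleftrightarrow>
     compact K \<and>
     (\<forall>n\<ge>1. finite (A n) \<and> A n \<subseteq> K \<and>
        (\<forall>p\<in>poly_space K n. sup_norm K p \<le> C * sup_norm (A n) p)) \<and>
     (\<exists>\<beta>\<ge>1. (\<lambda>n. real (card (A n))) \<in> O(\<lambda>n. real (poly_dim K n) powr \<beta>))"

definition optimal_polynomial_mesh ::
    "(real ^ 'd) set \<Rightarrow> real \<Rightarrow> (nat \<Rightarrow> (real ^ 'd) set) \<Rightarrow> bool" where
  "optimal_polynomial_mesh K C A \<longleftrightarrow>
     polynomial_mesh K C A \<and> (\<lambda>n. real (card (A n))) \<in> O(\<lambda>n. real (poly_dim K n))"

abbreviation S2 :: "(real ^ 3) set" where
  "S2 \<equiv> sphere 0 1"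

(* For finite nonempty X the supremum is attained, as S2 is compact. *)
definition covering_radius :: "(real ^ 3) set \<Rightarrow> real" where
  "covering_radius X = (SUP x\<in>S2. Min ((\<lambda>y. norm (x - y)) ` X))"

definition good_covering :: "real \<Rightarrow> (nat \<Rightarrow> (real ^ 3) set) \<Rightarrow> bool" where
  "good_covering \<alpha> X \<longleftrightarrow>
     \<alpha> > 0 \<and>
     (\<forall>M\<ge>2. finite (X M) \<and> X M \<subseteq> S2 \<and> card (X M) = M \<and>
        covering_radius (X M) \<le> \<alpha> / sqrt (real M))"

end

theory Submission
  imports Defs
begin

text \<open>Let \<open>\<bar>p\<bar>\<close> attain its maximum \<open>L\<close> over the sphere at \<open>x\<close>, and let \<open>y\<close> be a nearest mesh point. Since
  \<open>2 sin (\<delta> / 2) \<ge> \<delta> (1 - \<delta> / (2\<pi>))\<close> for \<open>\<delta> = \<theta> / n\<close>, the choice of \<open>\<sigma>\<close> puts \<open>y\<close> within geodesic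
  distance \<open>t \<le> \<theta> / n\<close> of \<open>x\<close>. On the great circle through \<open>x\<close> and \<open>y\<close> the polynomial \<open>p\<close> is a
  trigonometric polynomial of degree \<open>n\<close>. Instead of Bernstein's inequality, it suffices that near a
  maximum its even part dominates \<open>L cos (n t)\<close>, so that \<open>\<bar>p y\<bar> \<ge> L (1 - \<theta>\<^sup>2) \<ge> L (1 - \<theta>)\<close>. The
  cardinality is of optimal order because the monomials \<open>x\<^sub>1\<^sup>i x\<^sub>2\<^sup>j\<close> with \<open>i, j \<le> n div 2\<close>
  are linearly independent on the sphere, hence its polynomial space has dimension at least \<open>n\<^sup>2 / 4\<close>.\<close>

section \<open>Elementary estimates for sine and cosine\<close>

lemma one_minus_half_square_le_cos: "1 - x\<^sup>2 / 2 \<le> cos (x :: real)"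
proof -
  have "(sin (x / 2))\<^sup>2 \<le> (x / 2)\<^sup>2"
    using abs_sin_x_le_abs_x abs_le_square_iff by blast
  then show ?thesis using cos_double_sin[of "x / 2"] by (simp add: power_divide)
qed

text \<open>By the mean value theorem \<open>sin x = x * cos z\<close> with \<open>z < x\<close>,
  and \<open>x / 2\<close> is at most \<open>1 / 4\<close>, hence below \<open>1 / pi\<close>.
  Applied with \<open>x\<close> equal to \<theta> / (2 n), this is the estimate that the formula for
  \<sigma> is built around.\<close>

lemma sin_ge_minus_square_over_pi:
  assumes "0 \<le> x" "x \<le> 1 / 2"
  shows "x * (1 - x / pi) \<le> sin x"
proof (cases "x = 0")
  case False
  then have "0 < x" using assms by simp
  then obtain z where z: "0 < z" "z < x" "sin x - sin 0 = (x - 0) * cos z"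
    using MVT2[of 0 x sin cos] DERIV_sin by blast
  have "z\<^sup>2 \<le> x\<^sup>2" using z by simp
  moreover have "x * (x / 2) \<le> x * (1 / pi)"
    using assms mult_mono[of pi 4 x "1/2"] pi_less_4 pi_gt_zero
    by (intro mult_left_mono) (auto simp: field_simps)
  then have "x\<^sup>2 / 2 \<le> x / pi" by (simp add: power2_eq_square)
  ultimately have "1 - x / pi \<le> cos z" using one_minus_half_square_le_cos[of z] by linarith
  then show ?thesis using z assms by (simp add: mult_left_mono)
qed simp

section \<open>Sign alternation and comparison with Chebyshev polynomials\<close>

text \<open>The \<open>m\<close>-th coefficient of the Lagrange interpolant of \<open>Q\<close> at \<open>z 0, \<dots>, z m\<close> vanishes because
  \<open>degree Q < m\<close>; under the alternation hypothesis it is a sum of nonnegative terms.\<close>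

lemma poly_alternating_signs_imp_zero:
  fixes Q :: "real poly" and z :: "nat \<Rightarrow> real"
  assumes deg: "degree Q < m"
    and z: "\<And>i j. i < j \<Longrightarrow> j \<le> m \<Longrightarrow> z j < z i"
    and alt: "\<And>j. j \<le> m \<Longrightarrow> 0 \<le> (- 1) ^ j * poly Q (z j)"
    and "j \<le> m"
  shows "poly Q (z j) = 0"
proof -
  define w where "w j = (\<Prod>i\<in>{..m} - {j}. z j - z i)" for j
  define l where "l j = (\<Prod>i\<in>{..m} - {j}. [:- z i, 1:])" for j
  define P where "P = (\<Sum>j\<le>m. smult (poly Q (z j) / w j) (l j))"
  have inj: "inj_on z {..m}"
    by (rule inj_onI, metis z atMost_iff less_irrefl nat_neq_iff)
  \<comment> \<open>The nodes decrease, so exactly the \<open>j\<close> factors with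
    \<open>i < j\<close> are negative.\<close>
  have w_sign: "0 < (- 1) ^ j * w j" if "j \<le> m" for j
  proof -
    have split: "{..m} - {j} = {..<j} \<union> {j<..m}" using that by auto
    have "w j = (\<Prod>i<j. z j - z i) * (\<Prod>i\<in>{j<..m}. z j - z i)"
      unfolding w_def split by (rule prod.union_disjoint) auto
    moreover have "(\<Prod>i<j. z j - z i) = (- 1) ^ j * (\<Prod>i<j. z i - z j)"
    proof -
      have "(\<Prod>i<j. z j - z i) = (\<Prod>i<j. - 1 * (z i - z j))" by simp
      then show ?thesis by (simp only: prod.distrib prod_constant card_lessThan)
    qed
    moreover have "0 < (\<Prod>i<j. z i - z j)" "0 < (\<Prod>i\<in>{j<..m}. z j - z i)"
      using that by (auto intro!: prod_pos z)
    ultimately show ?thesis by (simp add: mult.assoc)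
  qed
  have w0: "w j \<noteq> 0" if "j \<le> m" for j using w_sign[OF that] by auto
  have deg_l: "degree (l j) = m" and lead_l: "coeff (l j) m = 1" if "j \<le> m" for j
  proof -
    have "card ({..m} - {j}) = m" using that by simp
    then show "degree (l j) = m"
      unfolding l_def by (subst degree_prod_eq_sum_degree) auto
    then show "coeff (l j) m = 1"
      using lead_coeff_prod[of "\<lambda>i. [:- z i, 1:]" "{..m} - {j}"] unfolding l_def by simp
  qed
  have P_eq: "poly P (z k) = poly Q (z k)" if "k \<le> m" for k
  proof -
    have "poly (l j) (z k) = (if j = k then w k else 0)" for j
      using that unfolding l_def w_def by (auto simp: poly_prod)
    then have "poly P (z k) = (\<Sum>j\<le>m. poly Q (z j) / w j * (if j = k then w k else 0))"
      unfolding P_def by (simp only: poly_sum poly_smult)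
    also have "\<dots> = (\<Sum>j\<le>m. if j = k then poly Q (z k) else 0)"
      by (intro sum.cong) (auto simp: w0)
    finally show ?thesis using that by simp
  qed
  have "P - Q = 0"
  proof (rule ccontr)
    assume nz: "P - Q \<noteq> 0"
    have "degree P \<le> m"
      unfolding P_def by (intro degree_sum_le) (auto intro: order_trans[OF degree_smult_le] simp: deg_l)
    then have "degree (P - Q) \<le> m" using deg by (intro degree_diff_le) auto
    moreover have "z ` {..m} \<subseteq> {x. poly (P - Q) x = 0}" using P_eq by auto
    then have "card (z ` {..m}) \<le> card {x. poly (P - Q) x = 0}"
      by (rule card_mono[OF poly_roots_finite[OF nz]])
    then have "Suc m \<le> degree (P - Q)"
      using card_poly_roots_bound[OF nz] inj by (simp add: card_image)
    ultimately show False by simp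
  qed
  then have "coeff P m = 0" using deg coeff_eq_0[of Q m] by simp
  then have "(\<Sum>j\<le>m. poly Q (z j) / w j) = 0" by (simp add: P_def coeff_sum lead_l)
  moreover have "0 \<le> poly Q (z j) / w j" if "j \<le> m" for j
  proof -
    have "poly Q (z j) / w j = ((- 1) ^ j * poly Q (z j)) / ((- 1) ^ j * w j)" by simp
    then show ?thesis using alt[OF that] w_sign[OF that] by (metis divide_nonneg_pos)
  qed
  ultimately have "poly Q (z j) / w j = 0"
    using \<open>j \<le> m\<close> by (subst (asm) sum_nonneg_eq_0_iff) auto
  then show ?thesis using w0 \<open>j \<le> m\<close> by simp
qed

text \<open>Adding the formulas for the cosine of \<open>(n + 1) t + t\<close> and
  \<open>(n + 1) t - t\<close> gives the recurrence \<open>2 x T - S\<close> for two consecutive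
  polynomials \<open>S\<close>, \<open>T\<close>.\<close>

lemma Chebyshev_poly_exists:
  "\<exists>T :: real poly. degree T \<le> n \<and> (\<forall>t. poly T (cos t) = cos (real n * t))"
proof (induction n rule: induct_nat_012)
  case 0
  show ?case by (rule exI[of _ 1]) simp
next
  case 1
  show ?case by (rule exI[of _ "[:0, 1:]"]) simp
next
  case (ge2 n)
  then obtain S T :: "real poly" where S: "degree S \<le> n" "\<And>t. poly S (cos t) = cos (real n * t)"
    and T: "degree T \<le> Suc n" "\<And>t. poly T (cos t) = cos (real (Suc n) * t)" by blast
  have "degree (smult 2 (pCons 0 T) - S) \<le> Suc (Suc n)"
    using S(1) T(1) by (intro degree_diff_le) (auto simp: degree_pCons_eq_if)
  moreover have "poly (smult 2 (pCons 0 T) - S) (cos t) = cos (real (Suc (Suc n)) * t)" for t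
  proof -
    have "real (Suc (Suc n)) * t = real (Suc n) * t + t" "real n * t = real (Suc n) * t - t"
      by (auto simp: algebra_simps)
    then show ?thesis
      by (simp only: poly_diff poly_smult poly_pCons S(2) T(2) cos_add cos_diff) simp
  qed
  ultimately show ?case by blast
qed

text \<open>If the inequality failed at \<open>t\<close>, then \<open>P - L T\<close>, with \<open>T\<close> the Chebyshev polynomial, would weakly
  alternate in sign at the \<open>n + 2\<close> points \<open>1\<close>, \<open>cos t\<close> and \<open>cos (k\<pi> / n)\<close>, \<open>1 \<le> k \<le> n\<close>.\<close>

lemma poly_cos_ge_Chebyshev:
  fixes P :: "real poly"
  assumes deg: "degree P \<le> n" and n: "1 \<le> n"
    and bound: "\<And>x. \<bar>x\<bar> \<le> 1 \<Longrightarrow> \<bar>poly P x\<bar> \<le> L" and at1: "poly P 1 = L"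
    and t: "0 < t" "t < pi / real n"
  shows "L * cos (real n * t) \<le> poly P (cos t)"
proof (rule ccontr)
  assume less: "\<not> L * cos (real n * t) \<le> poly P (cos t)"
  obtain T :: "real poly" where T: "degree T \<le> n" "\<And>t. poly T (cos t) = cos (real n * t)"
    using Chebyshev_poly_exists by blast
  define Q where "Q = P - smult L T"
  \<comment> \<open>The angles in increasing order: \<open>0\<close>, then \<open>t\<close>, which
    lies below \<open>pi / n\<close>, then \<open>k * pi / n\<close> for \<open>k = j - 1\<close>,
    ending with \<open>pi\<close> at \<open>j = n + 1\<close>.\<close>
  define s where "s j = (if j = 0 then 0 else if j = 1 then t else real (j - 1) * pi / real n)" for j
  define z where "z j = cos (s j)" for j
  have "poly T 1 = 1" using T(2)[of 0] by simp
  then have Q1: "poly Q 1 = 0" by (simp add: Q_def at1)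
  have s_mono: "s i < s j" if "i < j" for i j
  proof -
    have "pi / real n \<le> s j" if "2 \<le> j"
      using that n by (auto simp: s_def field_simps)
    with t show ?thesis using that n
      by (cases "i = 0"; cases "i = 1"; cases "j = 1") (auto simp: s_def divide_strict_right_mono)
  qed
  have s_le: "s j \<le> pi" if "j \<le> Suc n" for j
  proof -
    have "pi / real n \<le> pi" using n by (simp add: field_simps)
    moreover have "real (j - 1) \<le> real n" using that by simp
    then have "real (j - 1) * pi / real n \<le> pi" using n by (simp add: field_simps)
    ultimately show ?thesis using t unfolding s_def by (simp del: of_nat_diff)
  qed
  have s_ge: "0 \<le> s j" for j using t by (auto simp: s_def)
  have "poly Q (z 1) = 0"
  proof (rule poly_alternating_signs_imp_zero[where m = "Suc n"])
    show "degree Q < Suc n"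
      unfolding Q_def using deg T(1)
      by (auto simp: less_Suc_eq_le intro!: degree_diff_le order_trans[OF degree_smult_le])
    show "z j < z i" if "i < j" "j \<le> Suc n" for i j
      unfolding z_def using that by (intro cos_monotone_0_pi s_ge s_mono s_le)
    show "0 \<le> (- 1) ^ j * poly Q (z j)" if "j \<le> Suc n" for j
    proof -
      consider "j = 0" | "j = 1" | k where "j = Suc (Suc k)" by (metis One_nat_def not0_implies_Suc)
      then show ?thesis
      proof cases
        case 1
        then show ?thesis using Q1 by (simp add: z_def s_def)
      next
        case 2
        then show ?thesis using less by (simp add: z_def s_def Q_def T(2))
      next
        case 3
        \<comment> \<open>Here \<open>T\<close> takes the value 1 or -1, while \<open>P\<close> is
          bounded by \<open>L\<close>, so \<open>Q\<close> has weakly the sign opposite to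
          \<open>T\<close>, namely \<open>(- 1) ^ k\<close>, which equals
          \<open>(- 1) ^ j\<close>.\<close>
        have "real n * s j = real (Suc k) * pi" using n 3 by (simp add: s_def)
        then have "poly T (z j) = (- 1) ^ Suc k" unfolding z_def T(2) using cos_npi by metis
        moreover have "\<bar>poly P (z j)\<bar> \<le> L" by (rule bound) (simp add: z_def)
        ultimately show ?thesis
          unfolding Q_def 3 by (cases "even k") auto
      qed
    qed
  qed simp
  then show False using less by (simp add: z_def s_def Q_def T(2))
qed

section \<open>Trigonometric polynomials and restriction to great circles\<close>

text \<open>This form exhibits the even part as a polynomial in the cosine. The condition on
  \<open>pCons 0 B\<close> says that \<open>B\<close> has degree at most \<open>n - 1\<close>, and
  that \<open>B = 0\<close> if \<open>n = 0\<close>.\<close>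

definition trig_polys :: "nat \<Rightarrow> (real \<Rightarrow> real) set" where
  "trig_polys n = {f. \<exists>A B. degree A \<le> n \<and> degree (pCons 0 B) \<le> n \<and>
     f = (\<lambda>t. poly A (cos t) + sin t * poly B (cos t))}"

lemma trig_polys_mono: "m \<le> n \<Longrightarrow> trig_polys m \<subseteq> trig_polys n"
  unfolding trig_polys_def by (auto intro: order_trans)

lemma trig_polys_const: "(\<lambda>_. c) \<in> trig_polys n"
  unfolding trig_polys_def mem_Collect_eq
  by (rule exI[of _ "[:c:]"], rule exI[of _ 0]) simp

lemma trig_polys_add:
  assumes "f \<in> trig_polys n" "g \<in> trig_polys n"
  shows "(\<lambda>t. f t + g t) \<in> trig_polys n"
proof -
  from assms obtain A B C D where "degree A \<le> n" "degree (pCons 0 B) \<le> n"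
    "f = (\<lambda>t. poly A (cos t) + sin t * poly B (cos t))"
    "degree C \<le> n" "degree (pCons 0 D) \<le> n"
    "g = (\<lambda>t. poly C (cos t) + sin t * poly D (cos t))"
    unfolding trig_polys_def by blast
  moreover from this have "degree (pCons 0 (B + D)) \<le> n"
    using degree_add_le[of "pCons 0 B" n "pCons 0 D"] by simp
  ultimately show ?thesis unfolding trig_polys_def mem_Collect_eq
    by (intro exI[of _ "A + C"] exI[of _ "B + D"]) (auto simp: degree_add_le algebra_simps)
qed

lemma trig_polys_cmult:
  assumes "f \<in> trig_polys n"
  shows "(\<lambda>t. c * f t) \<in> trig_polys n"
proof -
  from assms obtain A B where "degree A \<le> n" "degree (pCons 0 B) \<le> n"
    "f = (\<lambda>t. poly A (cos t) + sin t * poly B (cos t))"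
    unfolding trig_polys_def by blast
  then show ?thesis unfolding trig_polys_def mem_Collect_eq
    by (intro exI[of _ "smult c A"] exI[of _ "smult c B"])
      (auto simp: algebra_simps degree_pCons_eq_if)
qed

text \<open>Replacing the square of the sine by \<open>1 - cos t * cos t\<close> restores the normal
  form; this is where the factor \<open>1 - x * x\<close> on \<open>B\<close> in \<open>A'\<close>
  comes from.\<close>

lemma trig_polys_mult_linear:
  assumes "f \<in> trig_polys n"
  shows "(\<lambda>t. f t * (a * cos t + b * sin t)) \<in> trig_polys (Suc n)"
proof -
  from assms obtain A B where A: "degree A \<le> n" and B: "degree (pCons 0 B) \<le> n"
    and f: "f = (\<lambda>t. poly A (cos t) + sin t * poly B (cos t))"
    unfolding trig_polys_def by blast
  define A' where "A' = smult a (pCons 0 A) + smult b (B - pCons 0 (pCons 0 B))"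
  define B' where "B' = smult a (pCons 0 B) + smult b A"
  have "degree A' \<le> Suc n" unfolding A'_def using A B
    by (intro degree_add_le degree_diff_le order_trans[OF degree_smult_le])
      (auto simp: degree_pCons_eq_if split: if_splits)
  moreover have "degree B' \<le> n" unfolding B'_def using A B
    by (intro degree_add_le order_trans[OF degree_smult_le])
  then have "degree (pCons 0 B') \<le> Suc n" by (simp add: degree_pCons_eq_if)
  moreover have "f t * (a * cos t + b * sin t) = poly A' (cos t) + sin t * poly B' (cos t)" for t
  proof -
    have "sin t * sin t = 1 - cos t * cos t"
      using sin_squared_eq[of t] by (simp add: power2_eq_square)
    then show ?thesis unfolding f A'_def B'_def by simp algebra
  qed
  ultimately show ?thesis unfolding trig_polys_def by blast
qed

lemma trig_polys_mult_linear_power: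
  assumes "f \<in> trig_polys n"
  shows "(\<lambda>t. f t * (a * cos t + b * sin t) ^ k) \<in> trig_polys (n + k)"
proof (induction k)
  case (Suc k)
  then show ?case using trig_polys_mult_linear[OF Suc, of a b] by (simp add: mult_ac)
qed (use assms in simp)

lemma trig_polys_monomial:
  assumes "finite S"
  shows "(\<lambda>t. c * (\<Prod>i\<in>S. (u i * cos t + v i * sin t) ^ e i)) \<in> trig_polys (sum e S)"
  using assms
proof (induction S rule: finite_induct)
  case empty
  show ?case using trig_polys_const by simp
next
  case (insert i S)
  then show ?case using trig_polys_mult_linear_power[OF insert.IH, of "u i" "v i" "e i"]
    by (simp add: mult_ac add_ac)
qed

lemma trig_polys_sum:
  assumes "\<And>a. a \<in> I \<Longrightarrow> f a \<in> trig_polys n"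
  shows "(\<lambda>t. \<Sum>a\<in>I. f a t) \<in> trig_polys n"
  using assms
  by (induction I rule: infinite_finite_induct) (auto intro: trig_polys_const trig_polys_add)

text \<open>Each coordinate becomes a combination of \<open>cos t\<close> and \<open>sin t\<close>,
  so a monomial turns into a product of as many linear factors as its total degree.\<close>

lemma poly_funs_on_circle:
  fixes u v :: "real ^ 'd"
  assumes "p \<in> poly_funs n"
  shows "(\<lambda>t. p (cos t *\<^sub>R u + sin t *\<^sub>R v)) \<in> trig_polys n"
proof -
  obtain c :: "('d \<Rightarrow> nat) \<Rightarrow> real" where
    p: "p = (\<lambda>x. \<Sum>a | (\<Sum>i\<in>UNIV. a i) \<le> n. c a * (\<Prod>i\<in>UNIV. (x $ i) ^ a i))"
    using assms unfolding poly_funs_def by auto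
  have "(\<lambda>t. c a * (\<Prod>i\<in>UNIV. (u $ i * cos t + v $ i * sin t) ^ a i)) \<in> trig_polys n"
    if "(\<Sum>i\<in>UNIV. a i) \<le> n" for a
    by (rule subsetD[OF trig_polys_mono[OF that] trig_polys_monomial]) simp
  then have "(\<lambda>t. \<Sum>a | (\<Sum>i\<in>UNIV. a i) \<le> n.
      c a * (\<Prod>i\<in>UNIV. (u $ i * cos t + v $ i * sin t) ^ a i)) \<in> trig_polys n"
    by (intro trig_polys_sum) auto
  then show ?thesis unfolding p by (simp add: mult.commute)
qed

text \<open>The even part of a trigonometric polynomial is a polynomial in the cosine, to which the
  comparison with the Chebyshev polynomial applies; the odd part costs at most the same amount
  again, because \<open>f (- t) \<le> L\<close>.\<close>

lemma trig_poly_near_maximum: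
  assumes f: "f \<in> trig_polys n" and n: "1 \<le> n"
    and bound: "\<And>t. \<bar>f t\<bar> \<le> L" and max: "f 0 = L"
    and t: "0 < t" "t < pi / real n"
  shows "L * (1 - (real n * t)\<^sup>2) \<le> f t"
proof -
  obtain A B where A: "degree A \<le> n" and f: "f = (\<lambda>t. poly A (cos t) + sin t * poly B (cos t))"
    using f unfolding trig_polys_def by blast
  have even: "2 * poly A (cos s) = f s + f (- s)" for s unfolding f by simp
  have "L * cos (real n * t) \<le> poly A (cos t)"
  proof (rule poly_cos_ge_Chebyshev[OF A n _ _ t])
    show "poly A 1 = L" using max unfolding f by simp
    show "\<bar>poly A x\<bar> \<le> L" if "\<bar>x\<bar> \<le> 1" for x
    proof -
      \<comment> \<open>\<open>poly A x\<close> is the mean of the values of \<open>f\<close> at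
        \<open>arccos x\<close> and \<open>- arccos x\<close>.\<close>
      have "cos (arccos x) = x" using that by (intro cos_arccos_abs)
      then show ?thesis
        using even[of "arccos x"] bound[of "arccos x"] bound[of "- arccos x"] by auto
    qed
  qed
  moreover have "f (- t) \<le> L" using bound[of "- t"] by simp
  ultimately have "L * (2 * cos (real n * t) - 1) \<le> f t"
    using even[of t] by (simp add: algebra_simps)
  moreover have "1 - (real n * t)\<^sup>2 \<le> 2 * cos (real n * t) - 1"
    using one_minus_half_square_le_cos[of "real n * t"] by simp
  moreover have "0 \<le> L" using bound[of 0] by simp
  ultimately show ?thesis by (meson mult_left_mono order_trans)
qed

section \<open>Norming sets on the sphere\<close>

text \<open>A chord of length \<open>2 * sin (d / 2)\<close> subtends the angle \<open>d\<close>.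
  The parameter \<open>t\<close> is the angle between \<open>x\<close> and \<open>y\<close>, and
  \<open>v\<close> is the normalised component of \<open>y\<close> orthogonal to
  \<open>x\<close>.\<close>

lemma sphere_point_on_great_circle:
  fixes x y :: "'a::euclidean_space"
  assumes "norm x = 1" "norm y = 1" "y \<noteq> x" "norm (x - y) \<le> 2 * sin (d / 2)" "0 \<le> d" "d < pi"
  obtains v t where "norm v = 1" "x \<bullet> v = 0" "0 < t" "t \<le> d" "y = cos t *\<^sub>R x + sin t *\<^sub>R v"
proof -
  have xx: "x \<bullet> x = 1" "y \<bullet> y = 1" using assms by (simp_all add: dot_square_norm)
  have dist: "(norm (x - y))\<^sup>2 = 2 - 2 * (x \<bullet> y)"
    by (simp add: power2_norm_eq_inner inner_diff inner_commute xx)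
  have "(norm (x - y))\<^sup>2 \<le> (2 * sin (d / 2))\<^sup>2" using assms(4) by (rule power_mono) simp
  then have "cos d \<le> x \<bullet> y" using cos_double_sin[of "d / 2"] by (simp add: dist power_mult_distrib)
  have "0 < (norm (x - y))\<^sup>2" using assms(3) by simp
  then have lt1: "x \<bullet> y < 1" unfolding dist by simp
  \<comment> \<open>As \<open>d < pi\<close>, the points are not antipodal; together with
    \<open>y \<noteq> x\<close> this makes \<open>sin t\<close> positive, so that \<open>v\<close>
    is well defined.\<close>
  have "- 1 < x \<bullet> y"
    using \<open>cos d \<le> x \<bullet> y\<close> cos_monotone_0_pi[of d pi] assms by simp
  define t where "t = arccos (x \<bullet> y)"
  have cos: "cos t = x \<bullet> y" and t: "0 \<le> t" "t \<le> pi"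
    using lt1 \<open>- 1 < x \<bullet> y\<close> by (auto simp: t_def arccos_lbound arccos_ubound)
  have "t \<noteq> 0" "t \<noteq> pi" using cos lt1 \<open>- 1 < x \<bullet> y\<close> by auto
  then have sin: "0 < sin t" using t by (intro sin_gt_zero) auto
  define v where "v = (1 / sin t) *\<^sub>R (y - cos t *\<^sub>R x)"
  show thesis
  proof
    show "x \<bullet> v = 0" by (simp add: v_def inner_diff_right xx cos)
    have "(norm (y - cos t *\<^sub>R x))\<^sup>2 = 1 - (cos t)\<^sup>2"
      unfolding power2_norm_eq_inner
      by (simp add: inner_diff inner_commute xx cos power2_eq_square)
    then have "(norm (y - cos t *\<^sub>R x))\<^sup>2 = (sin t)\<^sup>2" by (simp add: sin_squared_eq)
    then have "norm (y - cos t *\<^sub>R x) = sin t" using sin by (simp add: power2_eq_iff_nonneg)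
    then show "norm v = 1" using sin by (simp add: v_def)
    show "y = cos t *\<^sub>R x + sin t *\<^sub>R v" using sin by (simp add: v_def)
    show "0 < t" using t \<open>t \<noteq> 0\<close> by simp
    show "t \<le> d" using \<open>cos d \<le> x \<bullet> y\<close> cos t assms
      by (metis cos_monotone_0_pi not_le)
  qed
qed

lemma poly_funs_continuous: "p \<in> poly_funs n \<Longrightarrow> continuous_on S p"
  unfolding poly_funs_def by (auto intro!: continuous_intros)

lemma poly_funs_sphere_norming:
  fixes Y :: "(real ^ 'd) set"
  assumes p: "p \<in> poly_funs n" and n: "1 \<le> n" and \<theta>: "0 < \<theta>" "\<theta> < 1"
    and Y: "Y \<subseteq> sphere 0 1"
    and dense: "\<And>x. x \<in> sphere 0 1 \<Longrightarrow> \<exists>y\<in>Y. norm (x - y) \<le> 2 * sin (\<theta> / real n / 2)"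
  shows "\<exists>y\<in>Y. \<forall>x\<in>sphere 0 1. (1 - \<theta>) * \<bar>p x\<bar> \<le> \<bar>p y\<bar>"
proof -
  have "continuous_on (sphere 0 1) (\<lambda>x. \<bar>p x\<bar>)"
    by (intro continuous_intros poly_funs_continuous[OF p])
  then obtain x0 where x0: "x0 \<in> sphere 0 1" and max: "\<And>x. x \<in> sphere 0 1 \<Longrightarrow> \<bar>p x\<bar> \<le> \<bar>p x0\<bar>"
    using continuous_attains_sup[of "sphere 0 1 :: (real ^ 'd) set" "\<lambda>x. \<bar>p x\<bar>"] by auto
  obtain y where y: "y \<in> Y" and close: "norm (x0 - y) \<le> 2 * sin (\<theta> / real n / 2)"
    using dense[OF x0] by blast
  have "(1 - \<theta>) * \<bar>p x0\<bar> \<le> \<bar>p y\<bar>"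
  proof (cases "y = x0")
    case True
    then show ?thesis using \<theta> by (simp add: mult_left_le_one_le)
  next
    case False
    have "\<theta> / real n < pi / real n"
      using \<theta> n pi_gt3 by (intro divide_strict_right_mono) auto
    moreover have "pi / real n \<le> pi / 1" using n by (intro divide_left_mono) auto
    ultimately have "\<theta> / real n < pi" by simp
    then obtain v t where v: "norm v = 1" "x0 \<bullet> v = 0" and t: "0 < t" "t \<le> \<theta> / real n"
      and y_eq: "y = cos t *\<^sub>R x0 + sin t *\<^sub>R v"
      using sphere_point_on_great_circle[of x0 y "\<theta> / real n"] x0 y Y False close \<theta> by (auto simp: subset_iff)
    \<comment> \<open>The sign turns a negative minimum of \<open>p\<close> into a maximum, so that
      \<open>f 0\<close> is \<open>\<bar>p x0\<bar>\<close>; if \<open>p x0 = 0\<close>, then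
      \<open>f\<close> vanishes.\<close>
    define f where "f s = sgn (p x0) * p (cos s *\<^sub>R x0 + sin s *\<^sub>R v)" for s
    have circle: "cos s *\<^sub>R x0 + sin s *\<^sub>R v \<in> sphere 0 1" for s
    proof -
      have "(norm (cos s *\<^sub>R x0 + sin s *\<^sub>R v))\<^sup>2 = (cos s)\<^sup>2 * (norm x0)\<^sup>2 + (sin s)\<^sup>2 * (norm v)\<^sup>2"
        unfolding power2_norm_eq_inner
        by (simp add: inner_add inner_commute[of v x0] v(2) power2_eq_square)
      then show ?thesis using v x0 by (simp add: abs_square_eq_1)
    qed
    have "f \<in> trig_polys n"
      unfolding f_def by (intro trig_polys_cmult poly_funs_on_circle p)
    moreover have "\<bar>f s\<bar> \<le> \<bar>p x0\<bar>" for s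
      using max[OF circle[of s]] by (auto simp: f_def abs_mult sgn_if)
    moreover have "f 0 = \<bar>p x0\<bar>" by (simp add: f_def abs_sgn mult.commute)
    moreover have "t < pi / real n" using t \<open>\<theta> / real n < pi / real n\<close> by linarith
    ultimately have "\<bar>p x0\<bar> * (1 - (real n * t)\<^sup>2) \<le> f t"
      using n t(1) by (intro trig_poly_near_maximum) auto
    \<comment> \<open>The loss is at most the square of \<theta>, which is at most \<theta>.\<close>
    moreover have "1 - \<theta> \<le> 1 - (real n * t)\<^sup>2"
    proof -
      have "0 \<le> real n * t" "real n * t \<le> \<theta>" using t n by (auto simp: field_simps)
      then have "(real n * t)\<^sup>2 \<le> \<theta> * 1"
        unfolding power2_eq_square using \<theta> by (intro mult_mono) auto
      then show ?thesis by simp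
    qed
    then have "\<bar>p x0\<bar> * (1 - \<theta>) \<le> \<bar>p x0\<bar> * (1 - (real n * t)\<^sup>2)"
      by (rule mult_left_mono) simp
    moreover have "f t \<le> \<bar>p y\<bar>" by (auto simp: f_def y_eq sgn_if)
    ultimately show ?thesis by (simp add: mult.commute)
  qed
  moreover have "(1 - \<theta>) * \<bar>p x\<bar> \<le> (1 - \<theta>) * \<bar>p x0\<bar>" if "x \<in> sphere 0 1" for x
    using max[OF that] \<theta> by (intro mult_left_mono) auto
  ultimately show ?thesis using y order_trans by blast
qed

text \<open>The witness \<open>y\<close> also makes \<open>Y\<close> and \<open>K\<close> nonempty,
  so the default value of \<open>sup_norm\<close> on the empty set never enters.\<close>

lemma sup_norm_le_on_norming_set:
  assumes "finite Y" "Y \<subseteq> K" "0 < c" "\<exists>y\<in>Y. \<forall>x\<in>K. c * \<bar>p x\<bar> \<le> \<bar>p y\<bar>"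
  shows "sup_norm K p \<le> 1 / c * sup_norm Y p"
proof -
  obtain y where y: "y \<in> Y" "\<And>x. x \<in> K \<Longrightarrow> c * \<bar>p x\<bar> \<le> \<bar>p y\<bar>" using assms(4) by blast
  have "\<bar>p y\<bar> \<le> sup_norm Y p"
    unfolding sup_norm_def using y(1) assms(1) by (auto intro!: cSUP_upper)
  then have "1 / c * \<bar>p y\<bar> \<le> 1 / c * sup_norm Y p"
    using assms(3) by (intro mult_left_mono) auto
  moreover have "\<bar>p x\<bar> \<le> 1 / c * \<bar>p y\<bar>" if "x \<in> K" for x
    using y(2)[OF that] assms(3) by (simp add: field_simps)
  then have "sup_norm K p \<le> 1 / c * \<bar>p y\<bar>"
    unfolding sup_norm_def using y(1) assms(2) by (subst if_not_P) (auto intro: cSUP_least)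
  ultimately show ?thesis by linarith
qed

section \<open>Lower bound for the dimension of the polynomial space\<close>

lemma sum_fun_apply:
  fixes f :: "'i \<Rightarrow> 'a \<Rightarrow> 'b::comm_monoid_add"
  shows "(\<Sum>i\<in>I. f i) x = (\<Sum>i\<in>I. f i x)"
  by (induction I rule: infinite_finite_induct) auto

lemma finite_multi_indices: "finite {a :: 'd::finite \<Rightarrow> nat. (\<Sum>i\<in>UNIV. a i) \<le> n}"
proof (rule finite_subset)
  show "{a :: 'd \<Rightarrow> nat. (\<Sum>i\<in>UNIV. a i) \<le> n} \<subseteq> PiE UNIV (\<lambda>_. {..n})"
  proof
    fix a :: "'d \<Rightarrow> nat" assume "a \<in> {a. (\<Sum>i\<in>UNIV. a i) \<le> n}"
    moreover have "a i \<le> (\<Sum>i\<in>UNIV. a i)" for i by (rule member_le_sum) auto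
    ultimately have "a i \<le> n" for i using le_trans by blast
    then show "a \<in> PiE UNIV (\<lambda>_. {..n})" by auto
  qed
  show "finite (PiE (UNIV :: 'd set) (\<lambda>_. {..n}))" by (intro finite_PiE) auto
qed

text \<open>As \<open>dim\<close> is a cardinality, which is 0 for infinite bases, finite dimension
  has to be secured first: the finitely many monomials of degree at most \<open>n\<close>, cut off
  outside \<open>K\<close>, span the space.\<close>

lemma card_independent_le_poly_dim:
  fixes B :: "(real ^ 'd \<Rightarrow> real) set"
  assumes "fun_space.independent B" "B \<subseteq> poly_space K n"
  shows "card B \<le> poly_dim K n"
proof -
  define mono where "mono a = (\<lambda>x :: real ^ 'd. if x \<in> K then \<Prod>i\<in>UNIV. (x $ i) ^ a i else 0)" for a
  define F where "F = mono ` {a. (\<Sum>i\<in>UNIV. a i) \<le> n}"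
  have "finite F" unfolding F_def by (intro finite_imageI finite_multi_indices)
  have span: "poly_space K n \<subseteq> fun_space.span F"
  proof
    fix q assume "q \<in> poly_space K n"
    then obtain c :: "('d \<Rightarrow> nat) \<Rightarrow> real" where
      "q = (\<lambda>x. if x \<in> K then \<Sum>a | (\<Sum>i\<in>UNIV. a i) \<le> n. c a * (\<Prod>i\<in>UNIV. (x $ i) ^ a i) else 0)"
      unfolding poly_space_def poly_funs_def by blast
    then have "q = (\<Sum>a | (\<Sum>i\<in>UNIV. a i) \<le> n. (\<lambda>x. c a * mono a x))"
      by (auto simp: fun_eq_iff sum_fun_apply mono_def)
    also have "\<dots> \<in> fun_space.span F"
      unfolding F_def by (intro fun_space.span_sum fun_space.span_scale fun_space.span_base) auto
    finally show "q \<in> fun_space.span F" .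
  qed
  obtain E where E: "E \<subseteq> poly_space K n" "fun_space.independent E"
    "poly_space K n \<subseteq> fun_space.span E" "card E = fun_space.dim (poly_space K n)"
    by (rule fun_space.basis_exists)
  have "finite E"
    using fun_space.independent_span_bound[OF \<open>finite F\<close> E(2)] E(1) span by blast
  then show ?thesis
    using fun_space.independent_span_bound[OF _ assms(1), of E] E(3,4) assms(2)
    unfolding poly_dim_def by auto
qed

lemma monomial_in_poly_space:
  fixes e :: "'d::finite \<Rightarrow> nat"
  assumes "(\<Sum>i\<in>UNIV. e i) \<le> n"
  shows "(\<lambda>x :: real ^ 'd. if x \<in> K then \<Prod>i\<in>UNIV. (x $ i) ^ e i else 0) \<in> poly_space K n"
proof -
  have "(\<lambda>x :: real ^ 'd. \<Prod>i\<in>UNIV. (x $ i) ^ e i) \<in> poly_funs n"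
    unfolding poly_funs_def mem_Collect_eq
  proof (intro exI[of _ "\<lambda>a. if a = e then 1 else 0"] ext)
    fix x :: "real ^ 'd"
    have "(\<Sum>a | (\<Sum>i\<in>UNIV. a i) \<le> n. (if a = e then 1 else 0) * (\<Prod>i\<in>UNIV. (x $ i) ^ a i))
      = (\<Sum>a | (\<Sum>i\<in>UNIV. a i) \<le> n. if a = e then \<Prod>i\<in>UNIV. (x $ i) ^ e i else 0)"
      by (intro sum.cong) auto
    then show "(\<Prod>i\<in>UNIV. (x $ i) ^ e i) =
      (\<Sum>a | (\<Sum>i\<in>UNIV. a i) \<le> n. (if a = e then 1 else 0) * (\<Prod>i\<in>UNIV. (x $ i) ^ a i))"
      using assms by (simp add: finite_multi_indices)
  qed
  then show ?thesis unfolding poly_space_def by (rule image_eqI[rotated]) simp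
qed

lemma polynomial_zero_on_interval:
  fixes a :: "nat \<Rightarrow> real"
  assumes "l < u" "\<And>x. x \<in> {l..u} \<Longrightarrow> (\<Sum>i\<le>k. a i * x ^ i) = 0" "i \<le> k"
  shows "a i = 0"
proof (rule ccontr)
  assume "a i \<noteq> 0"
  then have "finite {x. (\<Sum>i\<le>k. a i * x ^ i) = 0}"
    using assms(3) polyfun_finite_roots by blast
  then have "finite {l..u}" by (rule rev_finite_subset) (use assms(2) in auto)
  then show False using infinite_Icc[OF assms(1)] by simp
qed

text \<open>Each pair \<open>(s, t)\<close> in the square with side \<open>1 / 2\<close> lifts to a
  point of the sphere with first coordinates \<open>s\<close> and \<open>t\<close>. A polynomial in
  two variables thus vanishes on a square, and its coefficients are eliminated one variable at a
  time.\<close>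

lemma sphere_monomials_coeffs_zero:
  fixes c :: "nat \<Rightarrow> nat \<Rightarrow> real"
  assumes zero: "\<And>x. x \<in> S2 \<Longrightarrow> (\<Sum>i\<le>k. \<Sum>j\<le>k. c i j * (x $ 1 ^ i * x $ 2 ^ j)) = 0"
    and ij: "i \<le> k" "j \<le> k"
  shows "c i j = 0"
proof -
  have "(\<Sum>i\<le>k. (\<Sum>j\<le>k. c i j * t ^ j) * s ^ i) = 0"
    if "s \<in> {0..1/2}" "t \<in> {0..1/2}" for s t :: real
  proof -
    define x :: "real ^ 3" where "x = vector [s, t, sqrt (1 - s\<^sup>2 - t\<^sup>2)]"
    have "s\<^sup>2 \<le> (1/2)\<^sup>2" "t\<^sup>2 \<le> (1/2)\<^sup>2" using that by (intro power_mono; simp)+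
    then have "x \<bullet> x = 1"
      by (simp add: x_def inner_vec_def sum_3 power2_eq_square)
    then have "x \<in> S2" by (simp add: norm_eq_1)
    from zero[OF this] show ?thesis
      by (simp add: x_def sum_distrib_left sum_distrib_right mult_ac)
  qed
  then have "(\<Sum>j\<le>k. c i j * t ^ j) = 0" if "t \<in> {0..1/2}" for t
    by (intro polynomial_zero_on_interval[where l = 0 and u = "1/2" and i = i and k = k
          and a = "\<lambda>i. \<Sum>j\<le>k. c i j * t ^ j"]) (use that ij in auto)
  then show ?thesis
    by (intro polynomial_zero_on_interval[where l = 0 and u = "1/2" and i = j and k = k
          and a = "c i"]) (use ij in auto)
qed

text \<open>Exponents up to \<open>n div 2\<close> in each of two variables keep the total degree at
  most \<open>n\<close>. The exact dimension is the square of \<open>n + 1\<close>; a bound of the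
  same order suffices for optimality.\<close>

lemma poly_dim_sphere_ge: "(n div 2 + 1)\<^sup>2 \<le> poly_dim S2 n"
proof -
  define k where "k = n div 2"
  define I where "I = {..k} \<times> {..k}"
  define g where "g = (\<lambda>(i, j) (x :: real ^ 3). if x \<in> S2 then x $ 1 ^ i * x $ 2 ^ j else 0)"
  have coeffs: "c r = 0" if "(\<Sum>r\<in>I. (\<lambda>x. c r * g r x)) = 0" "r \<in> I" for c :: "nat \<times> nat \<Rightarrow> real" and r
  proof -
    have "(\<Sum>i\<le>k. \<Sum>j\<le>k. c (i, j) * (x $ 1 ^ i * x $ 2 ^ j)) = 0" if "x \<in> S2" for x
    proof -
      have "(\<Sum>r\<in>I. c r * g r x) = 0"
        using fun_cong[OF \<open>(\<Sum>r\<in>I. (\<lambda>x. c r * g r x)) = 0\<close>, of x] by (simp add: sum_fun_apply)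
      then show ?thesis using that
        by (simp add: I_def g_def sum.cartesian_product case_prod_unfold)
    qed
    then show ?thesis
      using sphere_monomials_coeffs_zero[where k = k and c = "\<lambda>i j. c (i, j)"] \<open>r \<in> I\<close> by (auto simp: I_def)
  qed
  have "finite I" by (simp add: I_def)
  have inj: "inj_on g I"
  proof (rule inj_onI, rule ccontr)
    fix r s assume rs: "r \<in> I" "s \<in> I" "g r = g s" "r \<noteq> s"
    \<comment> \<open>If two monomials coincided on the sphere, their difference would be a
      vanishing combination with a coefficient 1.\<close>
    define c :: "nat \<times> nat \<Rightarrow> real" where "c q = of_bool (q = r) - of_bool (q = s)" for q
    have "(\<Sum>q\<in>I. c q * g q x) = g r x - g s x" for x
      using rs \<open>finite I\<close> by (simp add: c_def left_diff_distrib sum_subtractf)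
    then have "(\<Sum>q\<in>I. (\<lambda>x. c q * g q x)) = 0"
      using rs by (simp add: fun_eq_iff sum_fun_apply)
    from coeffs[OF this rs(1)] show False using rs by (simp add: c_def)
  qed
  have "fun_space.independent (g ` I)"
  proof (rule fun_space.independent_if_scalars_zero)
    show "finite (g ` I)" using \<open>finite I\<close> by simp
    fix c b assume "(\<Sum>b\<in>g ` I. (\<lambda>x. c b * b x)) = 0" "b \<in> g ` I"
    then show "c b = 0" using coeffs[of "c \<circ> g"] by (auto simp: sum.reindex[OF inj])
  qed
  moreover have "g r \<in> poly_space S2 n" if "r \<in> I" for r
  proof -
    obtain i j where r: "r = (i, j)" by (cases r)
    define e :: "3 \<Rightarrow> nat" where "e l = (if l = 1 then i else if l = 2 then j else 0)" for l
    have "(\<Sum>l\<in>UNIV. e l) \<le> n" using that by (auto simp: sum_3 e_def r I_def k_def)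
    then have "(\<lambda>x :: real ^ 3. if x \<in> S2 then \<Prod>l\<in>UNIV. (x $ l) ^ e l else 0) \<in> poly_space S2 n"
      by (rule monomial_in_poly_space)
    moreover have "(\<Prod>l\<in>UNIV. (x $ l) ^ e l) = x $ 1 ^ i * x $ 2 ^ j" for x :: "real ^ 3"
      unfolding UNIV_3 by (simp add: e_def)
    then have "g r = (\<lambda>x. if x \<in> S2 then \<Prod>l\<in>UNIV. (x $ l) ^ e l else 0)"
      by (simp add: g_def r fun_eq_iff)
    ultimately show ?thesis by simp
  qed
  ultimately have "card (g ` I) \<le> poly_dim S2 n"
    by (intro card_independent_le_poly_dim) auto
  moreover have "card (g ` I) = (k + 1)\<^sup>2"
    unfolding card_image[OF inj] by (simp add: I_def power2_eq_square)
  ultimately show ?thesis by (simp add: k_def)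
qed

section \<open>Covering radius and good coverings\<close>

text \<open>The supremum dominates its members only once boundedness is known; any fixed
  \<open>y0\<close> in \<open>Y\<close> provides the bound \<open>1 + norm y0\<close>. The minimum
  is attained because \<open>Y\<close> is finite.\<close>

lemma exists_within_covering_radius:
  assumes "finite Y" "Y \<noteq> {}" "x \<in> S2"
  shows "\<exists>y\<in>Y. norm (x - y) \<le> covering_radius Y"
proof -
  obtain y0 where "y0 \<in> Y" using assms(2) by blast
  have "Min ((\<lambda>y. norm (z - y)) ` Y) \<le> 1 + norm y0" if "z \<in> S2" for z
  proof -
    have "Min ((\<lambda>y. norm (z - y)) ` Y) \<le> norm (z - y0)"
      using assms(1) \<open>y0 \<in> Y\<close> by (intro Min_le) auto
    also have "\<dots> \<le> norm z + norm y0" by (rule norm_triangle_ineq4)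
    finally show ?thesis using that by simp
  qed
  then have "bdd_above ((\<lambda>z. Min ((\<lambda>y. norm (z - y)) ` Y)) ` S2)"
    by (intro bdd_aboveI2)
  then have "Min ((\<lambda>y. norm (x - y)) ` Y) \<le> covering_radius Y"
    unfolding covering_radius_def using assms(3) by (intro cSUP_upper)
  moreover have "Min ((\<lambda>y. norm (x - y)) ` Y) \<in> (\<lambda>y. norm (x - y)) ` Y"
    using assms by (intro Min_in) auto
  ultimately show ?thesis by auto
qed

text \<open>Two points of the sphere leave a point orthogonal to both of them uncovered up to distance
  \<open>sqrt 2\<close>; this guarantees that \<open>M n \<ge> 2\<close> in the theorem.\<close>

lemma good_covering_constant_ge:
  assumes "good_covering \<alpha> X"
  shows "2 \<le> \<alpha>"
proof -
  have X: "finite (X 2)" "X 2 \<subseteq> S2" "card (X 2) = 2" "covering_radius (X 2) \<le> \<alpha> / sqrt 2"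
    using assms unfolding good_covering_def by (auto dest!: spec[of _ 2])
  have "dim (X 2) < DIM(real ^ 3)" using dim_le_card'[OF X(1)] X(3) by simp
  then obtain a :: "real ^ 3" where a: "a \<noteq> 0" "span (X 2) \<subseteq> {x. a \<bullet> x = 0}"
    using lowdim_subset_hyperplane by blast
  define x where "x = a /\<^sub>R norm a"
  have x: "norm x = 1" "\<And>y. y \<in> X 2 \<Longrightarrow> x \<bullet> y = 0"
    using a span_base by (auto simp: x_def)
  obtain y where y: "y \<in> X 2" "norm (x - y) \<le> covering_radius (X 2)"
    using exists_within_covering_radius[OF X(1), of x] x X(3) by fastforce
  have "(norm (x - y))\<^sup>2 = (norm x)\<^sup>2 + (norm y)\<^sup>2"
    unfolding power2_norm_eq_inner using x(2)[OF y(1)] by (simp add: inner_diff inner_commute)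
  also have "\<dots> = 2" using x y X(2) by auto
  finally have "norm (x - y) = sqrt 2" by (metis norm_ge_zero real_sqrt_unique)
  then have "sqrt 2 \<le> \<alpha> / sqrt 2" using y X(4) by simp
  then show ?thesis by (simp add: field_simps)
qed

section \<open>Mesh constant, cardinality and asymptotics for good coverings\<close>

theorem proposition2:
  fixes X :: "nat \<Rightarrow> (real ^ 3) set" and \<alpha> \<theta> :: real
    and \<sigma> :: "nat \<Rightarrow> real" and M :: "nat \<Rightarrow> nat"
  assumes "good_covering \<alpha> X"
    and "0 < \<theta>" and "\<theta> < 1"
    and "\<And>n. n \<ge> 1 \<Longrightarrow> \<sigma> n = 2 * pi * \<alpha> / (\<theta> * (2 * pi - \<theta> / real n))"
    and "\<And>n. n \<ge> 1 \<Longrightarrow> M n = nat \<lceil>(\<sigma> n)\<^sup>2 * (real n)\<^sup>2\<rceil>"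
  shows "optimal_polynomial_mesh S2 (1 / (1 - \<theta>)) (\<lambda>n. X (M n))
    \<and> \<sigma> \<sim>[sequentially] (\<lambda>_. \<alpha> / \<theta>)"
proof -
  note \<theta> = assms(2,3) and \<sigma>_eq = assms(4) and M_eq = assms(5)
  have \<alpha>: "2 \<le> \<alpha>" using assms(1) by (rule good_covering_constant_ge)
  have den: "pi \<le> 2 * pi - \<theta> / real n" "2 * pi - \<theta> / real n \<le> 2 * pi" if "1 \<le> n" for n
  proof -
    have "\<theta> / real n \<le> \<theta> / 1" using that \<theta> by (intro divide_left_mono) auto
    then show "pi \<le> 2 * pi - \<theta> / real n" using \<theta> pi_gt3 by linarith
    show "2 * pi - \<theta> / real n \<le> 2 * pi" using \<theta> by simp
  qed
  have den_pos: "0 < 2 * pi - \<theta> / real n" if "1 \<le> n" for n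
    using den(1)[OF that] pi_gt_zero by linarith
  have \<sigma>_bounds: "\<alpha> / \<theta> \<le> \<sigma> n" "\<sigma> n \<le> 2 * \<alpha> / \<theta>" if "1 \<le> n" for n
  proof -
    have "2 * pi * \<alpha> / (\<theta> * (2 * pi)) \<le> \<sigma> n"
      unfolding \<sigma>_eq[OF that] using den[OF that] den_pos[OF that] \<theta> \<alpha>
      by (intro divide_left_mono mult_left_mono mult_pos_pos) auto
    then show "\<alpha> / \<theta> \<le> \<sigma> n" using \<theta> by (simp add: field_simps)
    have "\<sigma> n \<le> 2 * pi * \<alpha> / (\<theta> * pi)"
      unfolding \<sigma>_eq[OF that] using den[OF that] den_pos[OF that] \<theta> \<alpha>
      by (intro divide_left_mono mult_left_mono mult_pos_pos) auto
    then show "\<sigma> n \<le> 2 * \<alpha> / \<theta>" using \<theta> by (simp add: field_simps)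
  qed
  \<comment> \<open>This ensures \<open>M n \<ge> 2\<close>, the range in which a good covering is
    controlled.\<close>
  have \<sigma>_gt: "2 < \<sigma> n" if "1 \<le> n" for n
  proof -
    have "2 * \<theta> < \<alpha>" using \<theta> \<alpha> by simp
    then have "2 < \<alpha> / \<theta>" using \<theta> by (simp add: field_simps)
    then show ?thesis using \<sigma>_bounds(1)[OF that] by simp
  qed
  have M_ge: "(\<sigma> n * real n)\<^sup>2 \<le> real (M n)" and M_le: "real (M n) \<le> (\<sigma> n * real n)\<^sup>2 + 1"
    if "1 \<le> n" for n
  proof -
    have "0 \<le> (\<sigma> n * real n)\<^sup>2" by simp
    then have "real (M n) = of_int \<lceil>(\<sigma> n * real n)\<^sup>2\<rceil>"
      using M_eq[OF that] by (simp add: power_mult_distrib)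
    then show "(\<sigma> n * real n)\<^sup>2 \<le> real (M n)" "real (M n) \<le> (\<sigma> n * real n)\<^sup>2 + 1"
      by linarith+
  qed
  have M2: "2 \<le> M n" if "1 \<le> n" for n
  proof -
    have "2 * 1 \<le> \<sigma> n * real n" using \<sigma>_gt[OF that] that by (intro mult_mono) auto
    then have "2\<^sup>2 \<le> (\<sigma> n * real n)\<^sup>2" by (intro power_mono) auto
    then show ?thesis using M_ge[OF that] by simp
  qed
  have X: "finite (X (M n))" "X (M n) \<subseteq> S2" "card (X (M n)) = M n"
    "covering_radius (X (M n)) \<le> \<alpha> / sqrt (real (M n))" if "1 \<le> n" for n
    using assms(1) M2[OF that] unfolding good_covering_def by auto
  have radius: "covering_radius (X (M n)) \<le> 2 * sin (\<theta> / real n / 2)" if "1 \<le> n" for n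
  proof -
    define u where "u = \<theta> / real n / 2"
    have u: "0 \<le> u" "u \<le> 1 / 2" using \<theta> that by (auto simp: u_def field_simps)
    have pos: "0 < \<sigma> n * real n" using \<sigma>_gt[OF that] that by auto
    have "\<sigma> n * real n = sqrt ((\<sigma> n * real n)\<^sup>2)" using pos by simp
    also have "\<dots> \<le> sqrt (real (M n))" using M_ge[OF that] by (rule real_sqrt_le_mono)
    finally have "\<sigma> n * real n \<le> sqrt (real (M n))" .
    then have "\<alpha> / sqrt (real (M n)) \<le> \<alpha> / (\<sigma> n * real n)"
      using pos \<alpha> by (intro divide_left_mono mult_pos_pos[OF _ pos]) linarith+
    \<comment> \<open>The formula for \<sigma> is chosen to make this an identity: the covering
      radius is bounded by exactly the lower estimate of the chord \<open>2 * sin u\<close>.\<close>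
    also have "\<dots> = 2 * (u * (1 - u / pi))"
      using den[OF that] pi_gt_zero \<theta> \<alpha> that by (simp add: \<sigma>_eq[OF that] u_def field_simps)
    also have "\<dots> \<le> 2 * sin u" using sin_ge_minus_square_over_pi[OF u] by simp
    finally show ?thesis using X(4)[OF that] by (simp add: u_def)
  qed
  have norming: "sup_norm S2 q \<le> 1 / (1 - \<theta>) * sup_norm (X (M n)) q"
    if n: "1 \<le> n" and q: "q \<in> poly_space S2 n" for n q
  proof -
    obtain p where p: "p \<in> poly_funs n" and q_eq: "q = (\<lambda>x. if x \<in> S2 then p x else 0)"
      using q unfolding poly_space_def by blast
    have "X (M n) \<noteq> {}" using X(3)[OF n] M2[OF n] by auto
    then have "\<exists>y\<in>X (M n). norm (x - y) \<le> 2 * sin (\<theta> / real n / 2)" if "x \<in> S2" for x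
      using exists_within_covering_radius[OF X(1)[OF n] _ that] radius[OF n] order_trans by blast
    then obtain y where y: "y \<in> X (M n)" "\<forall>x\<in>S2. (1 - \<theta>) * \<bar>p x\<bar> \<le> \<bar>p y\<bar>"
      using poly_funs_sphere_norming[OF p n \<theta> X(2)[OF n]] by blast
    \<comment> \<open>\<open>q\<close> is \<open>p\<close> cut off outside the sphere, and all
      points compared lie on the sphere.\<close>
    have q_p: "q x = p x" if "x \<in> S2" for x using that by (simp add: q_eq)
    have "y \<in> S2" using y(1) X(2)[OF n] by blast
    have "\<exists>y\<in>X (M n). \<forall>x\<in>S2. (1 - \<theta>) * \<bar>q x\<bar> \<le> \<bar>q y\<bar>"
      using y(2) by (intro bexI[OF _ y(1)] ballI) (simp only: q_p \<open>y \<in> S2\<close>)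
    then show ?thesis
      using \<theta> X(1,2)[OF n] by (intro sup_norm_le_on_norming_set) auto
  qed
  have bigo: "(\<lambda>n. real (card (X (M n)))) \<in> O(\<lambda>n. real (poly_dim S2 n))"
  \<comment> \<open>The term \<open>(2 * \<alpha> / \<theta>)\<^sup>2\<close> bounds the square of
    \<sigma>, the summand 1 absorbs the rounding in \<open>M n\<close>, and the factor 4 comes from
    the dimension bound.\<close>
  proof (rule bigoI[where c = "4 * ((2 * \<alpha> / \<theta>)\<^sup>2 + 1)"])
    show "\<forall>\<^sub>F n in sequentially. norm (real (card (X (M n))))
      \<le> 4 * ((2 * \<alpha> / \<theta>)\<^sup>2 + 1) * norm (real (poly_dim S2 n))"
      using eventually_ge_at_top[of 1]
    proof eventually_elim
      case (elim n)
      have "(\<sigma> n)\<^sup>2 \<le> (2 * \<alpha> / \<theta>)\<^sup>2"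
        using \<sigma>_bounds[OF elim] \<sigma>_gt[OF elim] by (intro power_mono) auto
      then have "(\<sigma> n)\<^sup>2 * (real n)\<^sup>2 \<le> (2 * \<alpha> / \<theta>)\<^sup>2 * (real n)\<^sup>2"
        by (rule mult_right_mono) simp
      moreover have "1 \<le> (real n)\<^sup>2" using elim by simp
      ultimately have "real (M n) \<le> ((2 * \<alpha> / \<theta>)\<^sup>2 + 1) * (real n)\<^sup>2"
        using M_le[OF elim] by (simp add: power_mult_distrib distrib_right)
      also have "\<dots> \<le> ((2 * \<alpha> / \<theta>)\<^sup>2 + 1) * (4 * real (poly_dim S2 n))"
      proof (rule mult_left_mono)
        have "n\<^sup>2 \<le> (2 * (n div 2 + 1))\<^sup>2" by (intro power_mono) auto
        also have "\<dots> \<le> 4 * poly_dim S2 n"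
          using poly_dim_sphere_ge[of n] by (simp only: power_mult_distrib) simp
        finally show "(real n)\<^sup>2 \<le> 4 * real (poly_dim S2 n)"
          by (metis of_nat_le_iff of_nat_mult of_nat_numeral of_nat_power)
      qed simp
      finally show ?case by (simp add: X(3)[OF elim] algebra_simps)
    qed
  qed
  \<comment> \<open>With exponent 1 in the mesh condition, the same bound covers both cardinality
    requirements.\<close>
  have "optimal_polynomial_mesh S2 (1 / (1 - \<theta>)) (\<lambda>n. X (M n))"
    unfolding optimal_polynomial_mesh_def polynomial_mesh_def
    using X norming bigo by (auto intro!: exI[of _ "1 :: real"])
  moreover have "\<sigma> \<sim>[sequentially] (\<lambda>_. \<alpha> / \<theta>)"
  proof (rule tendsto_imp_asymp_equiv_const)
    have "(\<lambda>n. \<theta> / real n) \<longlonglongrightarrow> 0" by (rule lim_const_over_n)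
    then have "(\<lambda>n. 2 * pi * \<alpha> / (\<theta> * (2 * pi - \<theta> / real n)))
      \<longlonglongrightarrow> 2 * pi * \<alpha> / (\<theta> * (2 * pi - 0))"
      using \<theta> by (intro tendsto_intros) auto
    moreover have "2 * pi * \<alpha> / (\<theta> * (2 * pi - 0)) = \<alpha> / \<theta>" by simp
    moreover have "\<forall>\<^sub>F n in sequentially. 2 * pi * \<alpha> / (\<theta> * (2 * pi - \<theta> / real n)) = \<sigma> n"
      using eventually_ge_at_top[of 1] by eventually_elim (simp add: \<sigma>_eq)
    ultimately show "\<sigma> \<longlonglongrightarrow> \<alpha> / \<theta>" by (simp add: tendsto_cong)
    show "\<alpha> / \<theta> \<noteq> 0" using \<theta> \<alpha> by simp
  qed
  ultimately show ?thesis by blast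
qed

end
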